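(* Let $\mu$ be a compactly supported Borel probability measure on $\mathbb{R}^d$. Then both of the following chains of inequalities hold: \[ \overline{\dim}_{\mathrm{P}}\, \mu \ \le\ \sup_{x\in \mathrm{supp}(\mu)} \overline{\dim}_{\mathrm{loc}}(x,\mu) \ \le\ T(\mu)\ \le\ \overline{\dim}_{\mathrm{reg}}\, \mu \] and \[ \overline{\dim}_{\mathrm{P}}\, \mu \ \le\ \dim_{\mathrm{P}} \mathrm{supp}(\mu)\ \le\ \dim_{\mathrm{A}} \mathrm{supp}(\mu)\ \le\ \overline{\dim}_{\mathrm{reg}}\, \mu . \]
   Context: $B(x,r)$ denotes the open ball of centre $x$ and radius $r$, and $\mathrm{supp}(\mu)$ is the support of $\mu$. Upper regularity dimension: for a locally finite Borel measure $\mu$ on a metric space, $\overline{\dim}_{\mathrm{reg}}\,\mu$ is the infimum of all $s\ge 0$ for which there is a constant $C>0$ such that for all $0<r<R$ and all $x\in\mathrm{supp}(\mu)$, $\frac{\mu(B(x,R))}{\mu(B(x,r))}\le C\left(\frac{R}{r}\right)^s$ (with $\inf\emptyset=+\infty$). Upper local dimension at $x\in\mathrm{supp}(\mu)$: $\overline{\dim}_{\mathrm{loc}}(x,\mu)=\limsup_{r\to0}\frac{\log\mu(B(x,r))}{\log r}$. Upper packing dimension of $\mu$: $\overline{\dim}_{\mathrm{P}}\,\mu$ is the essential supremum (with respect to $\mu$) of $x\mapsto\overline{\dim}_{\mathrm{loc}}(x,\mu)$ over $x \in \mathrm{supp}(\mu)$. (Lower) $L^q$-spectrum: for $q\in\mathbb{R}$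 and $r>0$ let \[ M_r^q(\mu)=\sup\Big\{\sum_{i}\mu(B(x_i,r))^q\Big\}, \] the supremum being over all countable (possibly finite) families of points $x_i\in\mathrm{supp}(\mu)$ with $|x_i-x_j|>2r$ for $i\ne j$; then $\underline{\tau}(q)=\liminf_{r\to0}\frac{\log M_r^q(\mu)}{\log r}$. Top of the spectrum: $T(\mu)=\sup\{s\ge0:\ \underline{\tau}(q)<sq\ \text{ for all } q<0\}$, with the convention that the supremum is $0$ if the set is empty. For a set $F\subseteq\mathbb{R}^d$, $\dim_{\mathrm{P}}F$ is the packing dimension, and $\dim_{\mathrm{A}}F$ is the Assouad dimension, i.e. the infimum of all $s\ge0$ for which there is $C>0$ such that for all $0<r<R$ and $x\in F$, the set $B(x,R)\cap F$ can be covered by at most $C(R/r)^s$ balls of radius $r$. *)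

theory Defs
  imports "HOL-Probability.Probability"
begin

text \<open>
  The notions for measures are meant for finite Borel measures: masses of balls are real numbers
  (\<^const>\<open>measure\<close>). All dimensions take values in \<^typ>\<open>ereal\<close>, where the infimum of
  the empty set is \<^term>\<open>\<infinity> :: ereal\<close>.
\<close>

definition msupp :: "'a::metric_space measure \<Rightarrow> 'a set" where
  "msupp \<mu> = {x. \<forall>r>0. emeasure \<mu> (ball x r) > 0}"

definition upper_reg_dim :: "'a::metric_space measure \<Rightarrow> ereal" where
  "upper_reg_dim \<mu> = Inf {ereal s | s. 0 \<le> s \<and>
     (\<exists>C>0. \<forall>r R. \<forall>x\<in>msupp \<mu>. 0 < r \<longrightarrow> r < R \<longrightarrow>
        measure \<mu> (ball x R) / measure \<mu> (ball x r) \<le> C * (R / r) powr s)}"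

definition upper_local_dim :: "'a::metric_space measure \<Rightarrow> 'a \<Rightarrow> ereal" where
  "upper_local_dim \<mu> x =
     Limsup (at_right 0) (\<lambda>r. ereal (ln (measure \<mu> (ball x r)) / ln r))"

text \<open>
  The local dimension is only meaningful on the support, so the essential supremum is taken
  with respect to the restriction of the measure to its support.
\<close>

definition upper_packing_dim :: "'a::metric_space measure \<Rightarrow> ereal" where
  "upper_packing_dim \<mu> = esssup (restrict_space \<mu> (msupp \<mu>)) (upper_local_dim \<mu>)"

definition ln_ennreal :: "ennreal \<Rightarrow> ereal" where
  "ln_ennreal x = (if x = \<top> then \<infinity> else if x = 0 then -\<infinity> else ereal (ln (enn2real x)))"

text \<open>
  Points of an admissible family are pairwise distinct, so families are rendered as sets.
\<close>

definition Lq_moment :: "'a::metric_space measure \<Rightarrow> real \<Rightarrow> real \<Rightarrow> ennreal" where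
  "Lq_moment \<mu> q r =
     (SUP S \<in> {S. countable S \<and> S \<subseteq> msupp \<mu> \<and> (\<forall>x\<in>S. \<forall>y\<in>S. x \<noteq> y \<longrightarrow> dist x y > 2 * r)}.
        \<Sum>\<^sub>\<infinity>x\<in>S. ennreal (measure \<mu> (ball x r) powr q))"

definition Lq_spectrum :: "'a::metric_space measure \<Rightarrow> real \<Rightarrow> ereal" where
  "Lq_spectrum \<mu> q = Liminf (at_right 0) (\<lambda>r. ln_ennreal (Lq_moment \<mu> q r) / ereal (ln r))"

text \<open>
  Inserting 0 implements the convention that the supremum of the empty set is 0 here; it has no
  effect on a nonempty set of nonnegative numbers.
\<close>

definition spectrum_top :: "'a::metric_space measure \<Rightarrow> ereal" where
  "spectrum_top \<mu> =
     Sup (insert 0 {ereal s | s. 0 \<le> s \<and> (\<forall>q<0. Lq_spectrum \<mu> q < ereal (s * q))})"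

text \<open>
  Packing dimension via packing measures: \<open>packing_size \<delta> s F\<close> is the supremum of
  \<open>\<Sum> |B\<^sub>i|\<^sup>s\<close> over countable families of disjoint closed balls with centres in
  \<open>F\<close> and radii at most \<open>\<delta>\<close>, where \<open>|B\<^sub>i|\<close> is twice the radius. It decreases with
  \<open>\<delta>\<close>, so the limit as \<open>\<delta>\<close> tends to 0, the packing premeasure, is an infimum. A family of
  balls is given by the set of its pairs of centres and radii.
\<close>

definition packing_size :: "real \<Rightarrow> real \<Rightarrow> 'a::metric_space set \<Rightarrow> ennreal" where
  "packing_size \<delta> s F =
     (SUP B \<in> {B. countable B \<and> B \<subseteq> F \<times> {0<..\<delta>} \<and> disjoint_family_on (\<lambda>(x, r). cball x r) B}.
        \<Sum>\<^sub>\<infinity>(x, r)\<in>B. ennreal ((2 * r) powr s))"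

definition packing_premeasure :: "real \<Rightarrow> 'a::metric_space set \<Rightarrow> ennreal" where
  "packing_premeasure s F = (INF \<delta>\<in>{0<..}. packing_size \<delta> s F)"

definition packing_measure :: "real \<Rightarrow> 'a::metric_space set \<Rightarrow> ennreal" where
  "packing_measure s F =
     (INF G \<in> {G :: nat \<Rightarrow> 'a set. F \<subseteq> (\<Union>i. G i)}. \<Sum>i. packing_premeasure s (G i))"

definition packing_dim :: "'a::metric_space set \<Rightarrow> ereal" where
  "packing_dim F = Inf {ereal s | s. 0 \<le> s \<and> packing_measure s F = 0}"

definition assouad_dim :: "'a::metric_space set \<Rightarrow> ereal" where
  "assouad_dim F = Inf {ereal s | s. 0 \<le> s \<and>
     (\<exists>C>0. \<forall>r R. \<forall>x\<in>F. 0 < r \<longrightarrow> r < R \<longrightarrow>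
        (\<exists>A. finite A \<and> real (card A) \<le> C * (R / r) powr s \<and>
             ball x R \<inter> F \<subseteq> (\<Union>y\<in>A. ball y r)))}"

end

theory Submission
  imports Defs
begin

text \<open>
  All inequalities but the one between packing and Assouad dimension rest on comparing the masses of
  balls centred in the support with powers of their radii.

  If the upper local dimension at a point \<open>x\<close> of the support exceeds \<open>s\<close>, then arbitrarily small
  radii \<open>r\<close> satisfy \<open>\<mu>(B(x,r)) < r\<^sup>s\<close> (\<open>small_ball_of_less_upper_local_dim\<close>). This is used twice. The
  one-point family \<open>{x}\<close> gives \<open>M\<^sub>r\<^sup>q \<ge> \<mu>(B(x,r))\<^sup>q \<ge> r\<^bsup>sq\<^esup>\<close> for \<open>q < 0\<close>, so the \<open>L\<^sup>q\<close>-spectrum at \<open>q\<close> is at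
  most \<open>sq\<close>, and the top of the spectrum is at least the local dimension
  (\<open>upper_local_dim_le_spectrum_top\<close>). And a set of such points can be covered by the fivefold
  enlargements of a disjoint family of balls of this kind, by Vitali's lemma, so that its outer mass
  is at most a constant times its packing measure (\<open>outer_measure_le_packing_measure\<close>); if the
  packing measure of the support vanishes in dimension \<open>s\<close>, the local dimension is therefore at
  most \<open>s\<close> almost everywhere. The remaining bound on the packing dimension of the measure, by the
  supremum of the local dimensions, needs only that the local dimension is measurable, because an
  essential supremum of a non-measurable function is infinite by convention.

  Conversely, suppose that \<open>\<mu>(B(x,R)) \<le> C (R/r)\<^sup>s \<mu>(B(x,r))\<close> for all \<open>r < R\<close>. Taking \<open>R\<close> beyond the
  diameter of the support yields \<open>\<mu>(B(x,r)) \<ge> c r\<^sup>s\<close>. For \<open>q < 0\<close> the sum over a separated family is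
  \<open>\<Sum> \<mu>(B)\<^sup>q = \<Sum> \<mu>(B) \<mu>(B)\<^bsup>q-1\<^esup> \<le> (c r\<^sup>s)\<^bsup>q-1\<^esup>\<close> since the balls are disjoint, so the spectrum at \<open>q\<close> is at
  least \<open>s(q - 1)\<close>; letting \<open>q\<close> tend to \<open>-\<infinity>\<close> bounds the top of the spectrum by \<open>s\<close>
  (\<open>spectrum_top_le_upper_reg_dim\<close>). A maximal separated subset of a ball gives a covering,
  and comparing masses bounds its cardinality, whence the Assouad dimension is at most \<open>s\<close>
  (\<open>assouad_dim_msupp_le_upper_reg_dim\<close>).

  Finally, in a bounded set an Assouad bound with exponent \<open>s\<close> leaves room for only about
  \<open>2\<^bsup>ks\<^esup>\<close> disjoint balls of radius about \<open>2\<^bsup>-k\<^esup>\<close>, so for \<open>t > s\<close> the sums in the definition of the packing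
  premeasure are dominated by tails of a convergent geometric series (\<open>packing_premeasure_eq_0\<close>).
\<close>

section \<open>Extended reals and unordered sums\<close>

lemma infsum_ennreal_le:
  fixes f :: "'a \<Rightarrow> ennreal"
  assumes "\<And>P. finite P \<Longrightarrow> P \<subseteq> S \<Longrightarrow> sum f P \<le> b"
  shows "infsum f S \<le> b"
  using assms by (auto simp: nonneg_infsum_complete intro!: SUP_least)

lemma ln_ennreal_mono: "x \<le> y \<Longrightarrow> ln_ennreal x \<le> ln_ennreal y"
proof -
  assume xy: "x \<le> y"
  show ?thesis
  proof (cases "y = \<top> \<or> x = 0")
    case True
    then show ?thesis by (auto simp: ln_ennreal_def)
  next
    case False
    then have "y \<noteq> \<top>" "x \<noteq> 0" by auto
    then have "x \<noteq> \<top>" "y \<noteq> 0" using xy by (auto simp: top_unique)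
    have "enn2real x \<le> enn2real y" "0 < enn2real x"
      using xy \<open>y \<noteq> \<top>\<close> \<open>x \<noteq> \<top>\<close> \<open>x \<noteq> 0\<close>
      by (auto intro: enn2real_mono simp: enn2real_positive_iff top.not_eq_extremum zero_less_iff_neq_zero)
    then show ?thesis
      using \<open>y \<noteq> \<top>\<close> \<open>x \<noteq> \<top>\<close> \<open>x \<noteq> 0\<close> \<open>y \<noteq> 0\<close> by (simp add: ln_ennreal_def)
  qed
qed

lemma ln_ennreal_ennreal: "0 < c \<Longrightarrow> ln_ennreal (ennreal c) = ereal (ln c)"
  by (simp add: ln_ennreal_def)

text \<open>
  The exponents in the spectrum are quotients by \<open>ln r\<close>, which is negative for small \<open>r\<close>.
\<close>

lemma ereal_divide_right_antimono:
  assumes "a \<le> b" "c < 0"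
  shows "b / ereal c \<le> a / ereal c"
  using assms by (cases a; cases b) (auto simp: divide_right_mono_neg)

section \<open>The support and the measurability of the local dimension\<close>

locale borel_prob_space = prob_space M
  for M :: "'a::{metric_space, second_countable_topology} measure" +
  assumes sets_eq_borel [measurable_cong]: "sets M = sets borel"
begin

lemma space_eq_UNIV [simp]: "space M = UNIV"
  using sets_eq_imp_space_eq[OF sets_eq_borel] by simp

lemma ball_in_sets [simp]: "ball x r \<in> sets M"
  by (simp add: sets_eq_borel)

lemma measure_ball_pos: "x \<in> msupp M \<Longrightarrow> 0 < r \<Longrightarrow> 0 < measure M (ball x r)"
  by (auto simp: msupp_def emeasure_eq_measure)

lemma measure_ball_mono: "r \<le> R \<Longrightarrow> measure M (ball x r) \<le> measure M (ball x R)"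
  by (intro finite_measure_mono subset_ball) auto

text \<open>
  With the complement written as a union of null open sets, the Lindelof property leaves only
  countably many of them, so that the support carries the full mass.
\<close>

lemma compl_msupp_eq: "- msupp M = \<Union> {U. open U \<and> emeasure M U = 0}"
proof (intro equalityI subsetI)
  fix x assume "x \<in> - msupp M"
  then obtain r where "r > 0" "emeasure M (ball x r) = 0"
    by (auto simp: msupp_def)
  then show "x \<in> \<Union> {U. open U \<and> emeasure M U = 0}"
    by (intro UnionI[of "ball x r"]) auto
next
  fix x assume "x \<in> \<Union> {U. open U \<and> emeasure M U = 0}"
  then obtain U where U: "open U" "emeasure M U = 0" "x \<in> U" by auto
  then obtain r where r: "r > 0" "ball x r \<subseteq> U" by (auto simp: open_contains_ball)
  have "emeasure M (ball x r) \<le> emeasure M U"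
    by (rule emeasure_mono) (use U r in \<open>auto simp: sets_eq_borel\<close>)
  then show "x \<in> - msupp M"
    using U r by (auto simp: msupp_def)
qed

lemma closed_msupp: "closed (msupp M)"
  unfolding closed_def compl_msupp_eq by auto

lemma msupp_in_sets [simp]: "msupp M \<in> sets M"
  using closed_msupp by (simp add: sets_eq_borel)

lemma compl_msupp_null: "- msupp M \<in> null_sets M"
proof -
  obtain F where F: "F \<subseteq> {U. open U \<and> emeasure M U = 0}" "countable F"
      "\<Union> F = \<Union> {U. open U \<and> emeasure M U = 0}"
    by (rule Lindelof[of "{U. open U \<and> emeasure M U = 0}"]) auto
  have "(\<Union>U\<in>F. U) \<in> null_sets M"
    by (rule null_sets_UN') (use F in \<open>auto simp: null_sets_def sets_eq_borel\<close>)
  then show ?thesis using F(3) compl_msupp_eq by simp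
qed

lemma measure_superset_msupp:
  assumes "U \<in> sets M" "msupp M \<subseteq> U"
  shows "measure M U = 1"
proof -
  have "AE x in M. x \<in> U"
    using compl_msupp_null by (rule AE_I') (use assms in auto)
  then show ?thesis using assms(1) by (simp add: prob_eq_1)
qed

text \<open>
  Restricting the upper limit to countably many radii is what makes the local dimension measurable.
  Rational radii suffice: when \<open>r\<close> decreases slightly to \<open>u\<close>, the mass of the ball only decreases, so
  the quotient is at least \<open>ln \<mu>(B(x,r)) / ln u\<close>, which is close to the quotient at \<open>r\<close>. The bound \<open>1 / (n + 2)\<close> keeps the radii below 1,
  where the logarithm is negative.
\<close>

lemma upper_local_dim_eq_rational:
  assumes x: "x \<in> msupp M"
  shows "upper_local_dim M x =
    (INF n. SUP r\<in>\<rat> \<inter> {0<..<1 / real (n + 2)}. ereal (ln (measure M (ball x r)) / ln r))"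
    (is "_ = (INF n. ?h n)")
proof (rule antisym)
  let ?g = "\<lambda>r. ln (measure M (ball x r)) / ln r"
  show "upper_local_dim M x \<le> (INF n. ?h n)"
  proof (rule INF_greatest)
    fix n :: nat
    let ?d = "1 / real (n + 2)"
    have d: "0 < ?d" "?d < 1" by auto
    have "ereal (?g r) \<le> ?h n" if r: "0 < r" "r < ?d" for r
    proof (rule dense_le)
      fix c assume c: "c < ereal (?g r)"
      let ?m = "ln (measure M (ball x r))"
      have "r < 1" using r d by linarith
      have m: "measure M (ball x r) > 0" "?m \<le> 0"
        using measure_ball_pos[OF x r(1)] by (auto intro!: ln_le_zero_iff[THEN iffD2])
      have "((\<lambda>u. ?m / ln u) \<longlongrightarrow> ?m / ln r) (at_left r)"
        using r \<open>r < 1\<close> by (auto intro!: tendsto_intros)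
      then have "((\<lambda>u. ereal (?m / ln u)) \<longlongrightarrow> ereal (?g r)) (at_left r)"
        by simp
      from order_tendstoD(1)[OF this c] obtain b where b: "b < r" "\<And>u. b < u \<Longrightarrow> u < r \<Longrightarrow> c < ereal (?m / ln u)"
        by (auto simp: eventually_at_left_field)
      obtain u where u: "u \<in> \<rat>" "max b 0 < u" "u < r"
        using Rats_dense_in_real[of "max b 0" r] b r by auto
      have lu: "ln u < 0" using u \<open>r < 1\<close> by auto
      have "ln (measure M (ball x u)) \<le> ?m"
        using u measure_ball_pos[OF x, of u] measure_ball_mono[of u r x] by auto
      then have "?m / ln u \<le> ?g u"
        using lu by (simp add: divide_right_mono_neg)
      then have "c \<le> ereal (?g u)"
        using b(2)[of u] u by (auto intro: order.trans less_imp_le)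
      also have "\<dots> \<le> ?h n"
        by (rule SUP_upper) (use u r in auto)
      finally show "c \<le> ?h n" .
    qed
    then show "upper_local_dim M x \<le> ?h n"
      unfolding upper_local_dim_def
      using d(1) by (intro Limsup_bounded eventually_at_rightI[of 0 ?d]) (simp_all only: greaterThanLessThan_iff)
  qed
  show "(INF n. ?h n) \<le> upper_local_dim M x"
    unfolding upper_local_dim_def
  proof (rule Limsup_greatest)
    fix P :: "real \<Rightarrow> bool" assume "eventually P (at_right 0)"
    then obtain b where b: "b > 0" "\<And>r. 0 < r \<Longrightarrow> r < b \<Longrightarrow> P r"
      by (auto simp: eventually_at_right_field)
    obtain n where n: "1 / real (Suc n) < b"
      using nat_approx_posE[OF b(1)] by auto
    have "1 / real (n + 2) \<le> 1 / real (Suc n)" by (simp add: field_simps)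
    then have "1 / real (n + 2) < b" using n by linarith
    then have "?h n \<le> (SUP r\<in>Collect P. ereal (?g r))"
      by (intro SUP_subset_mono) (use b in auto)
    then show "(INF n. ?h n) \<le> (SUP r\<in>Collect P. ereal (?g r))"
      by (meson INF_lower2 UNIV_I)
  qed
qed

text \<open>
  The balls of radius \<open>r\<close> are the sections of an open subset of the product space.
\<close>

lemma measurable_measure_ball: "(\<lambda>x. measure M (ball x r)) \<in> borel_measurable M"
proof -
  let ?Q = "{p :: 'a \<times> 'a. dist (fst p) (snd p) < r}"
  have "open ?Q" by (intro open_Collect_less continuous_intros)
  then have "?Q \<in> sets (borel :: ('a \<times> 'a) measure)" by (rule borel_open)
  moreover have "sets (M \<Otimes>\<^sub>M M) = sets (borel :: ('a \<times> 'a) measure)"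
    using sets_pair_measure_cong[OF sets_eq_borel sets_eq_borel] by (simp only: borel_prod)
  ultimately have "?Q \<in> sets (M \<Otimes>\<^sub>M M)" by (simp only:)
  from measurable_emeasure_Pair[OF this]
  have "(\<lambda>x. emeasure M (ball x r)) \<in> borel_measurable M"
    by (simp add: ball_def vimage_def)
  then show ?thesis unfolding measure_def by measurable
qed

lemma measurable_upper_local_dim:
  "upper_local_dim M \<in> borel_measurable (restrict_space M (msupp M))"
proof -
  note [measurable] = measurable_measure_ball
  have "(\<lambda>x. INF n::nat. SUP r\<in>\<rat> \<inter> {0<..<1 / real (n + 2)}.
      ereal (ln (measure M (ball x r)) / ln r)) \<in> borel_measurable M"
    by (intro borel_measurable_INF borel_measurable_SUP) (auto intro: countable_rat)
  then have "(\<lambda>x. INF n::nat. SUP r\<in>\<rat> \<inter> {0<..<1 / real (n + 2)}.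
      ereal (ln (measure M (ball x r)) / ln r)) \<in> borel_measurable (restrict_space M (msupp M))"
    by (rule measurable_restrict_space1)
  then show ?thesis
    by (rule measurable_cong[THEN iffD1, rotated])
      (simp add: upper_local_dim_eq_rational space_restrict_space)
qed

lemma upper_packing_dim_le_SUP: "upper_packing_dim M \<le> (SUP x\<in>msupp M. upper_local_dim M x)"
  unfolding upper_packing_dim_def
  by (intro esssup_I measurable_upper_local_dim AE_I2 SUP_upper) (simp add: space_restrict_space)

lemma small_ball_of_less_upper_local_dim:
  assumes x: "x \<in> msupp M" and s: "ereal s < upper_local_dim M x" and "d > 0"
  shows "\<exists>r. 0 < r \<and> r < d \<and> r < 1 \<and> measure M (ball x r) < r powr s"
proof (rule ccontr)
  assume neg: "\<not> ?thesis"
  have "upper_local_dim M x \<le> ereal s"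
    unfolding upper_local_dim_def
  proof (rule Limsup_bounded)
    have "ln (measure M (ball x r)) / ln r \<le> s" if r: "0 < r" "r < min d 1" for r
    proof -
      have "r powr s \<le> measure M (ball x r)" using neg r by auto
      then have "ln (r powr s) \<le> ln (measure M (ball x r))"
        using r measure_ball_pos[OF x r(1)] by (subst ln_le_cancel_iff) auto
      then show ?thesis using r by (simp add: ln_powr neg_divide_le_eq)
    qed
    then show "\<forall>\<^sub>F r in at_right 0. ereal (ln (measure M (ball x r)) / ln r) \<le> ereal s"
      unfolding eventually_at_right_field using \<open>d > 0\<close> by (intro exI[of _ "min d 1"]) auto
  qed
  then show False using s by simp
qed

end

section \<open>Packing measure and mass\<close>

lemma packing_size_ge_sum:
  assumes "finite B" "B \<subseteq> F \<times> {0<..\<delta>}" "disjoint_family_on (\<lambda>(x, r). cball x r) B"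
  shows "(\<Sum>(x, r)\<in>B. ennreal ((2 * r) powr s)) \<le> packing_size \<delta> s F"
proof -
  have "(\<Sum>(x, r)\<in>B. ennreal ((2 * r) powr s)) = (\<Sum>\<^sub>\<infinity>(x, r)\<in>B. ennreal ((2 * r) powr s))"
    using assms(1) by simp
  also have "\<dots> \<le> packing_size \<delta> s F"
    unfolding packing_size_def
    by (rule SUP_upper) (use assms in \<open>auto intro: countable_finite\<close>)
  finally show ?thesis .
qed

lemma packing_size_le:
  assumes "\<And>B. finite B \<Longrightarrow> B \<subseteq> F \<times> {0<..\<delta>} \<Longrightarrow> disjoint_family_on (\<lambda>(x, r). cball x r) B \<Longrightarrow>
    (\<Sum>(x, r)\<in>B. (2 * r) powr s) \<le> c"
  shows "packing_size \<delta> s F \<le> ennreal c"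
  unfolding packing_size_def
proof (rule SUP_least, rule infsum_ennreal_le)
  fix B P assume B: "B \<in> {B. countable B \<and> B \<subseteq> F \<times> {0<..\<delta>} \<and> disjoint_family_on (\<lambda>(x, r). cball x r) B}"
    and P: "finite P" "P \<subseteq> B"
  have "(\<Sum>(x, r)\<in>P. ennreal ((2 * r) powr s)) = ennreal (\<Sum>(x, r)\<in>P. (2 * r) powr s)"
    by (simp add: case_prod_unfold)
  also have "\<dots> \<le> ennreal c"
    by (intro ennreal_leI assms) (use B P in \<open>auto intro: disjoint_family_on_mono\<close>)
  finally show "(\<Sum>(x, r)\<in>P. ennreal ((2 * r) powr s)) \<le> ennreal c" .
qed

text \<open>
  Packings enter through their finite subfamilies, so bounds on these have to be passed on to a
  countable union. The factor \<open>c\<close> sits on the left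
  because this form can be chained with infima on the right without dividing in \<^typ>\<open>ennreal\<close>.
\<close>

lemma mult_emeasure_countable_UN_le:
  assumes C: "countable C" and A: "\<And>x. x \<in> C \<Longrightarrow> A x \<in> sets M"
    and bound: "\<And>P. finite P \<Longrightarrow> P \<subseteq> C \<Longrightarrow> (\<Sum>x\<in>P. c * emeasure M (A x)) \<le> b"
  shows "c * emeasure M (\<Union>x\<in>C. A x) \<le> (b :: ennreal)"
proof (cases "C = {}")
  case False
  define P where "P n = from_nat_into C ` {..n}" for n :: nat
  have P: "finite (P n)" "P n \<subseteq> C" for n
    using from_nat_into[OF False] by (auto simp: P_def)
  have "(\<Union>n. P n) = range (from_nat_into C)" unfolding P_def by auto
  then have "C = (\<Union>n. P n)" using range_from_nat_into[OF False C] by simp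
  then have UN: "(\<Union>x\<in>C. A x) = (\<Union>n. \<Union>x\<in>P n. A x)" by auto
  have "(SUP n. emeasure M (\<Union>x\<in>P n. A x)) = emeasure M (\<Union>n. \<Union>x\<in>P n. A x)"
  proof (rule SUP_emeasure_incseq)
    show "range (\<lambda>n. \<Union>x\<in>P n. A x) \<subseteq> sets M"
      using P A by (auto intro!: sets.finite_UN)
    show "incseq (\<lambda>n. \<Union>x\<in>P n. A x)"
      by (intro monoI UN_mono) (auto simp: P_def)
  qed
  then have "c * emeasure M (\<Union>x\<in>C. A x) = (SUP n. c * emeasure M (\<Union>x\<in>P n. A x))"
    unfolding UN by (simp flip: SUP_mult_left_ennreal)
  also have "\<dots> \<le> b"
  proof (rule SUP_least)
    fix n
    have "c * emeasure M (\<Union>x\<in>P n. A x) \<le> c * (\<Sum>x\<in>P n. emeasure M (A x))"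
      using P A by (intro mult_left_mono emeasure_subadditive_finite) auto
    also have "\<dots> \<le> b" using bound[OF P] by (simp add: sum_distrib_left)
    finally show "c * emeasure M (\<Union>x\<in>P n. A x) \<le> b" .
  qed
  finally show ?thesis .
qed (use bound[of "{}"] in simp)

lemma outer_measure_of_UN_le:
  assumes "\<And>i::nat. A i \<subseteq> space M"
  shows "outer_measure_of M (\<Union>i. A i) \<le> (\<Sum>i. outer_measure_of M (A i))"
proof -
  have "\<forall>i. \<exists>E\<in>sets M. A i \<subseteq> E \<and> outer_measure_of M (A i) = emeasure M E"
    using outer_measure_of_attain[OF assms] by blast
  then obtain E where E: "\<And>i. E i \<in> sets M" "\<And>i. A i \<subseteq> E i"
    "\<And>i. outer_measure_of M (A i) = emeasure M (E i)" by metis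
  have "outer_measure_of M (\<Union>i. A i) \<le> outer_measure_of M (\<Union>i. E i)"
    using E(2) by (intro outer_measure_of_mono) blast
  also have "\<dots> = emeasure M (\<Union>i. E i)" using E(1) by (intro outer_measure_of_eq) auto
  also have "\<dots> \<le> (\<Sum>i. emeasure M (E i))"
    using E(1) by (intro emeasure_subadditive_countably) auto
  finally show ?thesis using E(3) by simp
qed

text \<open>
  Radii \<open>r = 6 \<rho>\<close> are chosen with \<open>\<mu>(B(x, 6 \<rho>)) < (6 \<rho>)\<^sup>s\<close>, and Vitali's lemma is applied to the balls of
  radius \<open>\<rho>\<close>: the disjoint ones among them form an admissible packing, and already their
  enlargements, whose mass is under control, cover the set. The constant is \<open>3\<^bsup>-s\<^esup>\<close> because \<open>6 \<rho>\<close> is three times the diameter \<open>2 \<rho>\<close> that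
  counts in the packing. Outer measure is used because the pieces of a covering of the set need not
  be measurable.
\<close>

lemma outer_measure_le_packing_premeasure:
  fixes M :: "'a::euclidean_space measure"
  assumes "borel_prob_space M"
    and small: "\<And>x d. x \<in> A \<Longrightarrow> 0 < d \<Longrightarrow> \<exists>r. 0 < r \<and> r < d \<and> measure M (ball x r) < r powr s"
  shows "ennreal ((1/3) powr s) * outer_measure_of M A \<le> packing_premeasure s A"
  unfolding packing_premeasure_def
proof (rule INF_greatest)
  interpret borel_prob_space M by fact
  fix \<delta> :: real assume "\<delta> \<in> {0<..}"
  then have \<delta>: "0 < \<delta>" by simp
  let ?c = "ennreal ((1/3) powr s)"
  have "\<exists>\<rho>. 0 < \<rho> \<and> \<rho> \<le> \<delta> \<and> measure M (ball x (6 * \<rho>)) < (6 * \<rho>) powr s" if x: "x \<in> A" for x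
  proof -
    obtain r where r: "0 < r" "r < 6 * \<delta>" "measure M (ball x r) < r powr s"
      using small[OF x, of "6 * \<delta>"] \<delta> by auto
    then show ?thesis by (intro exI[of _ "r / 6"]) auto
  qed
  then obtain \<rho> where \<rho>: "\<And>x. x \<in> A \<Longrightarrow> 0 < \<rho> x \<and> \<rho> x \<le> \<delta>"
    "\<And>x. x \<in> A \<Longrightarrow> measure M (ball x (6 * \<rho> x)) < (6 * \<rho> x) powr s" by metis
  have sub: "A \<subseteq> (\<Union>x\<in>A. cball x (\<rho> x))" using \<rho>(1) by (force intro: less_imp_le)
  obtain C where C: "countable C" "C \<subseteq> A"
    "pairwise (\<lambda>x y. disjnt (cball x (\<rho> x)) (cball y (\<rho> y))) C"
    "A \<subseteq> (\<Union>x\<in>C. cball x (5 * \<rho> x))"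
    by (rule Vitali_covering_lemma_cballs[OF sub \<rho>(1)]) (assumption, rule that)
  \<comment> \<open>Enlarging by 6 instead of 5 turns the closed balls of Vitali's lemma into open ones.\<close>
  have "A \<subseteq> (\<Union>x\<in>C. ball x (6 * \<rho> x))"
  proof
    fix y assume "y \<in> A"
    then obtain x where x: "x \<in> C" "dist x y \<le> 5 * \<rho> x" using C(4) by auto
    then have "dist x y < 6 * \<rho> x" using \<rho>(1)[of x] C(2) by auto
    then show "y \<in> (\<Union>x\<in>C. ball x (6 * \<rho> x))" using x by auto
  qed
  then have "outer_measure_of M A \<le> outer_measure_of M (\<Union>x\<in>C. ball x (6 * \<rho> x))"
    by (rule outer_measure_of_mono)
  also have "\<dots> = emeasure M (\<Union>x\<in>C. ball x (6 * \<rho> x))"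
    using C(1) by (intro outer_measure_of_eq sets.countable_UN') auto
  finally have "?c * outer_measure_of M A \<le> ?c * emeasure M (\<Union>x\<in>C. ball x (6 * \<rho> x))"
    by (intro mult_left_mono) auto
  also have "\<dots> \<le> packing_size \<delta> s A"
  proof (rule mult_emeasure_countable_UN_le[OF C(1)])
    fix P assume P: "finite P" "P \<subseteq> C"
    let ?B = "(\<lambda>x. (x, \<rho> x)) ` P"
    have "(\<Sum>x\<in>P. ?c * emeasure M (ball x (6 * \<rho> x))) \<le> (\<Sum>x\<in>P. ennreal ((2 * \<rho> x) powr s))"
    proof (rule sum_mono)
      fix x assume "x \<in> P"
      then have x: "x \<in> A" using P C(2) by auto
      have "(1/3) powr s * measure M (ball x (6 * \<rho> x)) \<le> (1/3) powr s * (6 * \<rho> x) powr s"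
        using \<rho>(2)[OF x] by (intro mult_left_mono) auto
      also have "\<dots> = (2 * \<rho> x) powr s"
        using \<rho>(1)[OF x] by (subst powr_mult[symmetric]) auto
      finally show "?c * emeasure M (ball x (6 * \<rho> x)) \<le> ennreal ((2 * \<rho> x) powr s)"
        by (simp add: emeasure_eq_measure ennreal_mult[symmetric] ennreal_leI)
    qed
    also have "\<dots> = (\<Sum>(x, r)\<in>?B. ennreal ((2 * r) powr s))"
      by (subst sum.reindex) (auto simp: inj_on_def)
    also have "\<dots> \<le> packing_size \<delta> s A"
    proof (rule packing_size_ge_sum)
      show "?B \<subseteq> A \<times> {0<..\<delta>}" using P C(2) \<rho>(1) by auto
      show "disjoint_family_on (\<lambda>(x, r). cball x r) ?B"
        unfolding disjoint_family_on_def
      proof (intro ballI impI)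
        fix a b assume ab: "a \<in> ?B" "b \<in> ?B" "a \<noteq> b"
        then obtain x y where "a = (x, \<rho> x)" "b = (y, \<rho> y)" "x \<in> C" "y \<in> C" "x \<noteq> y"
          using P by auto
        then show "(case a of (x, r) \<Rightarrow> cball x r) \<inter> (case b of (x, r) \<Rightarrow> cball x r) = {}"
          using C(3) by (auto simp: pairwise_def disjnt_def)
      qed
    qed (use P in simp)
    finally show "(\<Sum>x\<in>P. ?c * emeasure M (ball x (6 * \<rho> x))) \<le> packing_size \<delta> s A" .
  qed simp
  finally show "?c * outer_measure_of M A \<le> packing_size \<delta> s A" .
qed

lemma packing_premeasure_mono:
  assumes "F \<subseteq> G"
  shows "packing_premeasure s F \<le> packing_premeasure s G"
  unfolding packing_premeasure_def packing_size_def
  using assms by (intro INF_mono' SUP_subset_mono Collect_mono) auto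

lemma outer_measure_le_packing_measure:
  fixes M :: "'a::euclidean_space measure"
  assumes M: "borel_prob_space M"
    and small: "\<And>x d. x \<in> A \<Longrightarrow> 0 < d \<Longrightarrow> \<exists>r. 0 < r \<and> r < d \<and> measure M (ball x r) < r powr s"
    and "A \<subseteq> F"
  shows "ennreal ((1/3) powr s) * outer_measure_of M A \<le> packing_measure s F"
  unfolding packing_measure_def
proof (rule INF_greatest)
  interpret borel_prob_space M by fact
  fix G :: "nat \<Rightarrow> 'a set" assume "G \<in> {G. F \<subseteq> (\<Union>i. G i)}"
  then have G: "F \<subseteq> (\<Union>i. G i)" by simp
  let ?c = "ennreal ((1/3) powr s)"
  have "outer_measure_of M A = outer_measure_of M (\<Union>i. A \<inter> G i)"
    using G assms(3) by (intro arg_cong[of _ _ "outer_measure_of M"]) auto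
  also have "\<dots> \<le> (\<Sum>i. outer_measure_of M (A \<inter> G i))"
    by (rule outer_measure_of_UN_le) simp
  finally have "?c * outer_measure_of M A \<le> (\<Sum>i. ?c * outer_measure_of M (A \<inter> G i))"
    by (simp add: mult_left_mono)
  also have "\<dots> \<le> (\<Sum>i. packing_premeasure s (G i))"
  proof (intro suminf_le summableI)
    fix i
    have "?c * outer_measure_of M (A \<inter> G i) \<le> packing_premeasure s (A \<inter> G i)"
      by (rule outer_measure_le_packing_premeasure[OF M]) (use small in auto)
    also have "\<dots> \<le> packing_premeasure s (G i)" by (rule packing_premeasure_mono) auto
    finally show "?c * outer_measure_of M (A \<inter> G i) \<le> packing_premeasure s (G i)" .
  qed
  finally show "?c * outer_measure_of M A \<le> (\<Sum>i. packing_premeasure s (G i))" .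
qed

text \<open>
  The points of local dimension above \<open>s\<close> have small balls at arbitrarily small scales, so their
  outer mass is controlled by the \<open>s\<close>-dimensional packing measure of the support.
\<close>

lemma upper_packing_dim_le_packing_dim:
  fixes M :: "'a::euclidean_space measure"
  assumes M: "borel_prob_space M"
  shows "upper_packing_dim M \<le> packing_dim (msupp M)"
  unfolding packing_dim_def
proof (rule Inf_greatest, safe)
  interpret borel_prob_space M by fact
  fix s :: real assume null: "packing_measure s (msupp M) = 0"
  define A where "A = {x \<in> msupp M. ereal s < upper_local_dim M x}"
  have "ennreal ((1/3) powr s) * outer_measure_of M A \<le> packing_measure s (msupp M)"
    by (rule outer_measure_le_packing_measure[OF M])
      (use small_ball_of_less_upper_local_dim in \<open>fastforce simp: A_def\<close>)+
  then have "outer_measure_of M A = 0" using null by simp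
  then obtain E where E: "E \<in> sets M" "A \<subseteq> E" "emeasure M E = 0"
    using outer_measure_of_attain[of A M] by auto
  have "AE x in M. x \<in> msupp M \<longrightarrow> upper_local_dim M x \<le> ereal s"
    by (rule AE_I'[of E]) (use E in \<open>auto simp: A_def not_le\<close>)
  then have "AE x in restrict_space M (msupp M). upper_local_dim M x \<le> ereal s"
    by (simp add: AE_restrict_space_iff)
  then show "upper_packing_dim M \<le> ereal s"
    unfolding upper_packing_dim_def by (intro esssup_I measurable_upper_local_dim)
qed

section \<open>The spectrum between the local and the regularity dimension\<close>

context borel_prob_space
begin

text \<open>
  A one-point family is admissible in the moment, and a negative power of a small mass is large.
\<close>

lemma Lq_spectrum_le:
  assumes x: "x \<in> msupp M" and s: "ereal s < upper_local_dim M x" and q: "q < 0"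
  shows "Lq_spectrum M q \<le> ereal (s * q)"
proof (rule ccontr)
  assume "\<not> ?thesis"
  then have "ereal (s * q) < Lq_spectrum M q" by simp
  then have "\<forall>\<^sub>F r in at_right 0. ereal (s * q) < ln_ennreal (Lq_moment M q r) / ereal (ln r)"
    unfolding Lq_spectrum_def by (rule less_LiminfD)
  then obtain d where d: "d > 0"
    "\<And>r. 0 < r \<Longrightarrow> r < d \<Longrightarrow> ereal (s * q) < ln_ennreal (Lq_moment M q r) / ereal (ln r)"
    by (auto simp: eventually_at_right_field)
  obtain r where r: "0 < r" "r < d" "r < 1" "measure M (ball x r) < r powr s"
    using small_ball_of_less_upper_local_dim[OF x s d(1)] by auto
  have m: "measure M (ball x r) > 0" using x r by (simp add: measure_ball_pos)
  have "(r powr s) powr q \<le> measure M (ball x r) powr q"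
    using m r q by (intro powr_mono2') auto
  then have "ennreal (r powr (s * q)) \<le> (\<Sum>\<^sub>\<infinity>y\<in>{x}. ennreal (measure M (ball y r) powr q))"
    by (simp add: powr_powr ennreal_leI)
  also have "\<dots> \<le> Lq_moment M q r"
    unfolding Lq_moment_def by (rule SUP_upper) (use x in auto)
  finally have "ln_ennreal (ennreal (r powr (s * q))) \<le> ln_ennreal (Lq_moment M q r)"
    by (rule ln_ennreal_mono)
  then have "ereal (s * q * ln r) \<le> ln_ennreal (Lq_moment M q r)"
    using r by (simp add: ln_ennreal_ennreal ln_powr)
  then have "ln_ennreal (Lq_moment M q r) / ereal (ln r) \<le> ereal (s * q * ln r) / ereal (ln r)"
    by (rule ereal_divide_right_antimono) (use r in auto)
  also have "\<dots> = ereal (s * q)" using r by simp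
  finally show False using d(2)[OF r(1,2)] by simp
qed

text \<open>
  The top of the spectrum asks for a strict inequality for the spectrum. Two exponents \<open>t < u\<close>
  below the local dimension provide it, as \<open>u q < t q\<close> for negative \<open>q\<close>.
\<close>

lemma upper_local_dim_le_spectrum_top:
  assumes x: "x \<in> msupp M"
  shows "upper_local_dim M x \<le> spectrum_top M"
proof (rule dense_le)
  fix t' assume t': "t' < upper_local_dim M x"
  obtain t where t: "t' < ereal t" "ereal t < upper_local_dim M x"
    using ereal_dense2[OF t'] by auto
  obtain u where u: "t < u" "ereal u < upper_local_dim M x"
    using ereal_dense2[OF t(2)] by auto
  show "t' \<le> spectrum_top M"
  proof (cases "t \<ge> 0")
    case True
    have "Lq_spectrum M q < ereal (t * q)" if "q < 0" for q
    proof -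
      have "Lq_spectrum M q \<le> ereal (u * q)" by (rule Lq_spectrum_le[OF x u(2) that])
      also have "\<dots> < ereal (t * q)" using u that by simp
      finally show ?thesis .
    qed
    then have "ereal t \<le> spectrum_top M"
      unfolding spectrum_top_def using True by (intro Sup_upper) auto
    then show ?thesis using t by simp
  next
    case False
    then have "ereal t \<le> 0" by simp
    moreover have "0 \<le> spectrum_top M" unfolding spectrum_top_def by (intro Sup_upper) auto
    ultimately show ?thesis using t by (meson order.trans less_imp_le)
  qed
qed

text \<open>
  Splitting \<open>\<mu>(B)\<^sup>q\<close> as \<open>\<mu>(B) \<mu>(B)\<^bsup>q-1\<^esup>\<close> replaces a count of the points of a separated family: the first
  factors add up to at most 1 because the balls are disjoint.
\<close>

lemma Lq_moment_le:
  assumes m: "\<And>x. x \<in> msupp M \<Longrightarrow> b \<le> measure M (ball x r)" and "b > 0" "r > 0" "q < 0"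
  shows "Lq_moment M q r \<le> ennreal (b powr (q - 1))"
  unfolding Lq_moment_def
proof (rule SUP_least, rule infsum_ennreal_le)
  fix S P assume S: "S \<in> {S. countable S \<and> S \<subseteq> msupp M \<and> (\<forall>x\<in>S. \<forall>y\<in>S. x \<noteq> y \<longrightarrow> dist x y > 2 * r)}"
    and P: "finite P" "P \<subseteq> S"
  let ?m = "\<lambda>x. measure M (ball x r)"
  have disj: "disjoint_family_on (\<lambda>x. ball x r) P"
    unfolding disjoint_family_on_def
  proof (intro ballI impI)
    fix x y assume "x \<in> P" "y \<in> P" "x \<noteq> y"
    then have "dist x y > 2 * r" using S P by blast
    then show "ball x r \<inter> ball y r = {}" by (intro disjoint_ballI) auto
  qed
  have "(\<Sum>x\<in>P. ?m x powr q) \<le> (\<Sum>x\<in>P. ?m x * b powr (q - 1))"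
  proof (rule sum_mono)
    fix x assume "x \<in> P"
    then have mx: "b \<le> ?m x" using S P m by blast
    then have "?m x powr q = ?m x * ?m x powr (q - 1)"
      using \<open>b > 0\<close> by (simp add: powr_diff)
    also have "\<dots> \<le> ?m x * b powr (q - 1)"
      using mx assms(2,4) by (intro mult_left_mono powr_mono2') auto
    finally show "?m x powr q \<le> ?m x * b powr (q - 1)" .
  qed
  also have "\<dots> = measure M (\<Union>x\<in>P. ball x r) * b powr (q - 1)"
    using P disj by (subst finite_measure_finite_Union) (auto simp: sum_distrib_right)
  also have "\<dots> \<le> 1 * b powr (q - 1)"
    by (intro mult_right_mono) auto
  finally have "(\<Sum>x\<in>P. ?m x powr q) \<le> b powr (q - 1)" by simp
  then show "(\<Sum>x\<in>P. ennreal (?m x powr q)) \<le> ennreal (b powr (q - 1))"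
    by (simp add: ennreal_leI)
qed

lemma Lq_spectrum_ge:
  assumes m: "\<And>x r. x \<in> msupp M \<Longrightarrow> 0 < r \<Longrightarrow> r < 1 \<Longrightarrow> c * r powr s \<le> measure M (ball x r)"
    and "c > 0" and q: "q < 0"
  shows "ereal (s * (q - 1)) \<le> Lq_spectrum M q"
proof -
  let ?f = "\<lambda>r. (q - 1) * (ln c * inverse (ln r) + s)"
  have "filterlim ln at_infinity (at_right (0::real))"
    using ln_at_0 by (rule filterlim_mono) (auto simp: at_bot_le_at_infinity)
  then have "((\<lambda>r::real. inverse (ln r)) \<longlongrightarrow> 0) (at_right 0)"
    by (rule filterlim_compose[OF tendsto_inverse_0])
  then have "(?f \<longlongrightarrow> (q - 1) * (ln c * 0 + s)) (at_right 0)"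
    by (intro tendsto_intros)
  then have "((\<lambda>r. ereal (?f r)) \<longlongrightarrow> ereal (s * (q - 1))) (at_right 0)"
    by (simp add: mult.commute)
  then have "ereal (s * (q - 1)) = Liminf (at_right 0) (\<lambda>r. ereal (?f r))"
    by (intro lim_imp_Liminf[symmetric]) auto
  also have "\<dots> \<le> Lq_spectrum M q"
    unfolding Lq_spectrum_def
  proof (rule Liminf_mono)
    have "ereal (?f r) \<le> ln_ennreal (Lq_moment M q r) / ereal (ln r)" if r: "0 < r" "r < 1" for r
    proof -
      have pos: "0 < c * r powr s" using \<open>c > 0\<close> r by simp
      have "Lq_moment M q r \<le> ennreal ((c * r powr s) powr (q - 1))"
        by (rule Lq_moment_le) (use m r pos q in auto)
      then have "ln_ennreal (Lq_moment M q r) \<le> ln_ennreal (ennreal ((c * r powr s) powr (q - 1)))"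
        by (rule ln_ennreal_mono)
      also have "\<dots> = ereal ((q - 1) * (ln c + s * ln r))"
        using pos r \<open>c > 0\<close> by (subst ln_ennreal_ennreal) (auto simp: ln_powr ln_mult)
      finally have "ereal ((q - 1) * (ln c + s * ln r)) / ereal (ln r)
          \<le> ln_ennreal (Lq_moment M q r) / ereal (ln r)"
        by (rule ereal_divide_right_antimono) (use r in auto)
      moreover have "(q - 1) * (ln c + s * ln r) / ln r = ?f r"
        using r by (simp add: field_simps)
      ultimately show ?thesis using r by simp
    qed
    then show "\<forall>\<^sub>F r in at_right 0. ereal (?f r) \<le> ln_ennreal (Lq_moment M q r) / ereal (ln r)"
      by (intro eventually_at_right_field[THEN iffD2] exI[of _ 1]) auto
  qed
  finally show ?thesis .
qed

text \<open>
  The larger ball in the regularity condition is taken to contain the whole support, and so has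
  mass 1.
\<close>

lemma measure_ball_ge_powr:
  assumes bdd: "bounded (msupp M)" and C: "C > 0"
    and reg: "\<And>r R x. x \<in> msupp M \<Longrightarrow> 0 < r \<Longrightarrow> r < R \<Longrightarrow>
      measure M (ball x R) / measure M (ball x r) \<le> C * (R / r) powr s"
  obtains c where "c > 0"
    "\<And>x r. x \<in> msupp M \<Longrightarrow> 0 < r \<Longrightarrow> r < 1 \<Longrightarrow> c * r powr s \<le> measure M (ball x r)"
proof -
  obtain e where e: "\<And>x y. x \<in> msupp M \<Longrightarrow> y \<in> msupp M \<Longrightarrow> dist x y \<le> e"
    using bdd by (auto simp: bounded_two_points)
  \<comment> \<open>\<open>D\<close> exceeds the diameter and every radius below 1.\<close>
  define D where "D = max e 0 + 1"
  have D: "D \<ge> 1" "e < D" by (auto simp: D_def)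
  show thesis
  proof (rule that[of "1 / (C * D powr s)"])
    show "0 < 1 / (C * D powr s)" using C D by simp
    fix x r assume x: "x \<in> msupp M" and r: "0 < r" "r < (1::real)"
    have "msupp M \<subseteq> ball x D" using e[OF x] D by fastforce
    then have "measure M (ball x D) = 1" by (intro measure_superset_msupp) auto
    then have "1 / measure M (ball x r) \<le> C * (D / r) powr s"
      using reg[OF x r(1), of D] r D by auto
    also have "\<dots> = C * D powr s / r powr s" using r D by (simp add: powr_divide)
    finally show "1 / (C * D powr s) * r powr s \<le> measure M (ball x r)"
      using measure_ball_pos[OF x r(1)] r C D by (simp add: field_simps)
  qed
qed

text \<open>
  The bounds \<open>s (q - 1) \<le> \<tau>(q) < t q\<close> force \<open>t < s (1 - 1/q)\<close> for every negative \<open>q\<close>, and the right-hand side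
  tends to \<open>s\<close>.
\<close>

lemma spectrum_top_le_upper_reg_dim:
  assumes "bounded (msupp M)"
  shows "spectrum_top M \<le> upper_reg_dim M"
  unfolding upper_reg_dim_def
proof (rule Inf_greatest, safe)
  fix s C :: real
  assume s: "0 \<le> s" and C: "0 < C"
    and reg: "\<forall>r R. \<forall>x\<in>msupp M. 0 < r \<longrightarrow> r < R \<longrightarrow>
      measure M (ball x R) / measure M (ball x r) \<le> C * (R / r) powr s"
  obtain c where c: "c > 0"
    "\<And>x r. x \<in> msupp M \<Longrightarrow> 0 < r \<Longrightarrow> r < 1 \<Longrightarrow> c * r powr s \<le> measure M (ball x r)"
    using measure_ball_ge_powr[OF assms C, of s] reg by blast
  have "t \<le> s" if t: "\<And>q. q < 0 \<Longrightarrow> Lq_spectrum M q < ereal (t * q)" for t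
  proof (rule ccontr)
    assume "\<not> t \<le> s"
    then have ts: "0 < t - s" by simp
    \<comment> \<open>For \<open>q = - n\<close> the two bounds give \<open>(t - s) n < s\<close>, which fails once \<open>n\<close> exceeds \<open>s / (t - s)\<close>.\<close>
    define n where "n = s / (t - s) + 1"
    have n: "n > 0" "(t - s) * n = s + (t - s)"
      using ts s by (auto simp: n_def field_simps intro!: add_nonneg_pos divide_nonneg_pos)
    have "ereal (s * (- n - 1)) \<le> Lq_spectrum M (- n)"
      by (rule Lq_spectrum_ge[OF c(2,1)]) (use n in auto)
    also have "\<dots> < ereal (t * (- n))" using n by (intro t) auto
    finally have "(t - s) * n < s" by (simp add: algebra_simps)
    then show False using n(2) ts by linarith
  qed
  then show "spectrum_top M \<le> ereal s"
    unfolding spectrum_top_def using s by (intro Sup_least) auto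
qed

end

section \<open>Packing and Assouad dimension\<close>

definition assouad_bound :: "real \<Rightarrow> real \<Rightarrow> 'a::metric_space set \<Rightarrow> bool" where
  "assouad_bound C s F \<longleftrightarrow> (\<forall>r R. \<forall>x\<in>F. 0 < r \<longrightarrow> r < R \<longrightarrow>
        (\<exists>A. finite A \<and> real (card A) \<le> C * (R / r) powr s \<and>
             ball x R \<inter> F \<subseteq> (\<Union>y\<in>A. ball y r)))"

text \<open>
  A covering ball of radius \<open>\<rho> / 2\<close> contains at most one point of a \<open>\<rho>\<close>-separated set, and one
  application of the Assouad condition, at the scale of the diameter, covers all of the bounded set.
\<close>

lemma card_separated_le:
  fixes F :: "'a::metric_space set"
  assumes F: "bounded F" and C: "C > 0" and cover: "assouad_bound C s F"
  shows "\<exists>K>0. \<forall>P \<rho>. P \<subseteq> F \<longrightarrow> 0 < \<rho> \<longrightarrow> \<rho> < 1 \<longrightarrow> pairwise (\<lambda>x y. \<rho> < dist x y) P \<longrightarrow>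
    real (card P) \<le> K * \<rho> powr - s"
proof (cases "F = {}")
  case True
  then show ?thesis by (intro exI[of _ 1]) auto
next
  case False
  then obtain x0 where x0: "x0 \<in> F" by auto
  obtain e where e: "\<And>y. y \<in> F \<Longrightarrow> dist x0 y \<le> e"
    using F bounded_any_center[of F x0] by auto
  define D where "D = max e 0 + 1"
  have D: "D \<ge> 1" "e < D" by (auto simp: D_def)
  have "F \<subseteq> ball x0 D"
  proof
    fix y assume "y \<in> F"
    then show "y \<in> ball x0 D" using e[of y] D by simp
  qed
  note D = D(1) this
  show ?thesis
  proof (intro exI[of _ "C * (2 * D) powr s"] conjI allI impI)
    show "C * (2 * D) powr s > 0" using C D by auto
    fix P \<rho> assume P: "P \<subseteq> F" and \<rho>: "0 < \<rho>" "\<rho> < 1"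
      and sep: "pairwise (\<lambda>x y. \<rho> < dist x y) P"
    obtain A where A: "finite A" "real (card A) \<le> C * (D / (\<rho> / 2)) powr s"
      "ball x0 D \<inter> F \<subseteq> (\<Union>y\<in>A. ball y (\<rho> / 2))"
      using cover[unfolded assouad_bound_def, rule_format, OF x0, of "\<rho> / 2" D] \<rho> D by auto
    have "\<forall>x\<in>P. \<exists>y\<in>A. dist y x < \<rho> / 2"
      using A(3) D(2) P by (auto simp: subset_eq)
    then obtain f where f: "\<And>x. x \<in> P \<Longrightarrow> f x \<in> A \<and> dist (f x) x < \<rho> / 2" by metis
    have "inj_on f P"
    proof (rule inj_onI, rule ccontr)
      fix x y assume xy: "x \<in> P" "y \<in> P" "f x = f y" "x \<noteq> y"
      then have "dist x y \<le> dist (f x) x + dist (f y) y"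
        using dist_triangle3[of x y "f x"] by simp
      then show False using f[OF xy(1)] f[OF xy(2)] pairwiseD[OF sep xy(1,2,4)] by linarith
    qed
    then have "card P \<le> card A"
      by (rule card_inj_on_le) (use f A in auto)
    then have "real (card P) \<le> C * (D / (\<rho> / 2)) powr s" using A(2) by linarith
    also have "(D / (\<rho> / 2)) powr s = (2 * D) powr s * \<rho> powr - s"
      using \<rho> D by (simp add: powr_divide powr_minus powr_mult field_simps)
    finally show "real (card P) \<le> C * (2 * D) powr s * \<rho> powr - s" by simp
  qed
qed

lemma obtain_dyadic_scale:
  assumes "0 < (r::real)" "r \<le> 1"
  shows "\<exists>k. (1/2) ^ Suc k < r \<and> r \<le> (1/2) ^ k"
proof -
  obtain n where n: "(1/2::real) ^ n < r" using real_arch_pow_inv[of r "1/2"] assms by auto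
  define m where "m = (LEAST n. (1/2::real) ^ n < r)"
  have m: "(1/2) ^ m < r" unfolding m_def using n by (rule LeastI)
  then have "m \<noteq> 0" using assms by (intro notI) simp
  then obtain k where k: "m = Suc k" by (cases m) auto
  then have "\<not> (1/2) ^ k < r" unfolding m_def by (intro not_less_Least) simp
  then show ?thesis using m k by (intro exI[of _ k]) auto
qed

lemma sum_power_tail_le:
  fixes p :: real
  assumes "0 \<le> p" "p < 1" "finite I" "I \<subseteq> {n..}"
  shows "(\<Sum>k\<in>I. p ^ k) \<le> p ^ n / (1 - p)"
proof -
  have "(\<Sum>k\<in>I. p ^ k) = (\<Sum>k\<in>I. p ^ n * p ^ (k - n))"
    using assms by (intro sum.cong refl) (auto simp flip: power_add)
  also have "\<dots> = p ^ n * (\<Sum>j\<in>(\<lambda>k. k - n) ` I. p ^ j)"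
  proof -
    have "inj_on (\<lambda>k. k - n) I"
      by (rule inj_onI) (use assms(4) in \<open>metis atLeast_iff eq_diff_iff subsetD\<close>)
    then show ?thesis by (simp add: sum.reindex sum_distrib_left)
  qed
  also have "(\<Sum>j\<in>(\<lambda>k. k - n) ` I. p ^ j) \<le> (\<Sum>j. p ^ j)"
    using assms by (intro sum_le_suminf summable_geometric) auto
  also have "(\<Sum>j. p ^ j) = 1 / (1 - p)"
    using assms by (intro suminf_geometric) auto
  finally show ?thesis using assms by (simp add: mult_left_mono)
qed

text \<open>
  The balls are sorted by dyadic scale. The centres of disjoint balls of radius greater than \<open>\<rho>\<close> are
  \<open>\<rho>\<close>-separated, so at scale \<open>\<rho> = 2\<^bsup>-j-1\<^esup>\<close> there are at most \<open>K \<rho>\<^bsup>-s\<^esup>\<close> of them, each contributing at most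
  \<open>(4 \<rho>)\<^sup>t\<close>. What remains is a geometric series in \<open>\<rho>\<^bsup>t-s\<^esup>\<close>, starting at scale \<open>n\<close>.
  Separation by one radius is all that a general metric space provides: the centres of disjoint
  balls may be closer to each other than the sum of the radii.
\<close>

lemma packing_sum_le:
  fixes F :: "'a::metric_space set"
  assumes K: "K > 0"
    and card: "\<And>P \<rho>. P \<subseteq> F \<Longrightarrow> 0 < \<rho> \<Longrightarrow> \<rho> < 1 \<Longrightarrow>
      pairwise (\<lambda>x y. \<rho> < dist x y) P \<Longrightarrow> real (card P) \<le> K * \<rho> powr - s"
    and st: "0 \<le> s" "s < t"
    and B: "finite B" "B \<subseteq> F \<times> {0<..(1/2) ^ n}" "disjoint_family_on (\<lambda>(x, r). cball x r) B"
  shows "(\<Sum>(x, r)\<in>B. (2 * r) powr t)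
    \<le> K * 4 powr t * (((1/2) powr (t - s)) ^ n / (1 - (1/2) powr (t - s)))"
proof -
  define p :: real where "p = (1/2) powr (t - s)"
  have p: "0 < p" "p < 1"
    using st powr_less_mono'[of "1/2" 0 "t - s"] by (auto simp: p_def)
  have "\<forall>r. 0 < r \<and> r \<le> 1 \<longrightarrow> (\<exists>k. (1/2) ^ Suc k < (r::real) \<and> r \<le> (1/2) ^ k)"
    using obtain_dyadic_scale by blast
  then obtain k where k: "\<And>r. 0 < r \<Longrightarrow> r \<le> (1::real) \<Longrightarrow> (1/2) ^ Suc (k r) < r \<and> r \<le> (1/2) ^ k r"
    by metis
  have B1: "x \<in> F" "0 < r" "r \<le> (1/2) ^ n" "r \<le> 1" if "(x, r) \<in> B" for x r
    using that B(2) power_le_one[of "1/2 :: real" n] by auto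
  have scale: "(\<Sum>(x, r)\<in>{b \<in> B. k (snd b) = j}. (2 * r) powr t) \<le> K * 4 powr t * p ^ j" for j
  proof -
    let ?B = "{b \<in> B. k (snd b) = j}"
    define \<rho> :: real where "\<rho> = (1/2) ^ Suc j"
    have \<rho>: "0 < \<rho>" "\<rho> < 1" unfolding \<rho>_def by (simp, intro power_Suc_less_one) auto
    have r: "\<rho> < r" "r \<le> 2 * \<rho>" if "(x, r) \<in> ?B" for x r
      using that k[of r] B1[of x r] by (auto simp: \<rho>_def)
    have sep: "\<rho> < dist x y" if "(x, r) \<in> ?B" "(y, u) \<in> ?B" "(x, r) \<noteq> (y, u)" for x r y u
    proof -
      have "cball x r \<inter> cball y u = {}"
        using disjoint_family_onD[OF B(3), of "(x, r)" "(y, u)"] that by auto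
      moreover have "y \<in> cball y u" using r(1)[OF that(2)] \<rho> by auto
      ultimately have "y \<notin> cball x r" by auto
      then show ?thesis using r(1)[OF that(1)] by auto
    qed
    have inj: "inj_on fst ?B"
    proof (rule inj_onI, rule ccontr)
      fix a b assume ab: "a \<in> ?B" "b \<in> ?B" "fst a = fst b" "a \<noteq> b"
      obtain x r y u where "a = (x, r)" "b = (y, u)" by (cases a, cases b)
      then have "\<rho> < dist x y" "x = y" using ab sep[of x r y u] by auto
      then show False using \<rho> by simp
    qed
    have "real (card (fst ` ?B)) \<le> K * \<rho> powr - s"
    proof (rule card)
      show "fst ` ?B \<subseteq> F" using B1 by auto
      show "pairwise (\<lambda>x y. \<rho> < dist x y) (fst ` ?B)"
        using sep by (fastforce intro!: pairwiseI)
    qed (use \<rho> in auto)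
    then have cardB: "real (card ?B) \<le> K * \<rho> powr - s" using inj by (simp add: card_image)
    have "(\<Sum>(x, r)\<in>?B. (2 * r) powr t) \<le> real (card ?B) * (4 * \<rho>) powr t"
    proof (rule sum_bounded_above)
      fix b assume b: "b \<in> ?B"
      obtain x r where [simp]: "b = (x, r)" by (cases b)
      show "(case b of (x, r) \<Rightarrow> (2 * r) powr t) \<le> (4 * \<rho>) powr t"
        using r[of x r] b \<rho> st by (auto intro!: powr_mono2)
    qed
    also have "\<dots> \<le> K * \<rho> powr - s * (4 * \<rho>) powr t"
      using cardB by (intro mult_right_mono) auto
    also have "\<dots> = K * 4 powr t * \<rho> powr (t - s)"
      using \<rho> by (simp add: powr_mult powr_diff powr_minus field_simps)
    also have "\<rho> powr (t - s) = p ^ Suc j"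
      unfolding \<rho>_def p_def
      by (simp only: powr_realpow[symmetric] powr_powr mult.commute[of "t - s"])
        (simp add: powr_realpow[symmetric] powr_powr mult.commute flip: powr_add, simp add: algebra_simps)
    also have "\<dots> \<le> p ^ j" using p by (intro power_decreasing) auto
    finally show ?thesis using K by (simp add: mult_left_mono)
  qed
  have kn: "n \<le> k r" if "(x, r) \<in> B" for x r
  proof -
    have "(1/2::real) ^ Suc (k r) < (1/2) ^ n" using k[of r] B1[OF that] by linarith
    then have "n < Suc (k r)"
      by (subst (asm) power_strict_decreasing_iff) auto
    then show ?thesis by simp
  qed
  have "(\<Sum>(x, r)\<in>B. (2 * r) powr t)
      = (\<Sum>j\<in>(\<lambda>b. k (snd b)) ` B. \<Sum>(x, r)\<in>{b \<in> B. k (snd b) = j}. (2 * r) powr t)"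
    by (rule sum.image_gen[OF B(1)])
  also have "\<dots> \<le> (\<Sum>j\<in>(\<lambda>b. k (snd b)) ` B. K * 4 powr t * p ^ j)"
    by (intro sum_mono scale)
  also have "\<dots> = K * 4 powr t * (\<Sum>j\<in>(\<lambda>b. k (snd b)) ` B. p ^ j)"
    by (simp add: sum_distrib_left)
  also have "\<dots> \<le> K * 4 powr t * (p ^ n / (1 - p))"
    using K p B(1) kn by (intro mult_left_mono sum_power_tail_le) auto
  finally show ?thesis by (simp add: p_def)
qed

lemma packing_premeasure_eq_0:
  fixes F :: "'a::metric_space set"
  assumes F: "bounded F" and C: "C > 0" and cover: "assouad_bound C s F" and st: "0 \<le> s" "s < t"
  shows "packing_premeasure t F = 0"
proof -
  obtain K where K: "K > 0"
    "\<forall>P \<rho>. P \<subseteq> F \<longrightarrow> 0 < \<rho> \<longrightarrow> \<rho> < 1 \<longrightarrow> pairwise (\<lambda>x y. \<rho> < dist x y) P \<longrightarrow>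
    real (card P) \<le> K * \<rho> powr - s"
    using card_separated_le[OF F C cover] by blast
  define p :: real where "p = (1/2) powr (t - s)"
  have p: "0 < p" "p < 1"
    using st powr_less_mono'[of "1/2" 0 "t - s"] by (auto simp: p_def)
  have bound: "packing_premeasure t F \<le> ennreal (K * 4 powr t * (p ^ n / (1 - p)))" for n
  proof -
    have "packing_premeasure t F \<le> packing_size ((1/2) ^ n) t F"
      unfolding packing_premeasure_def by (rule INF_lower) simp
    also have "\<dots> \<le> ennreal (K * 4 powr t * (p ^ n / (1 - p)))"
      unfolding p_def by (rule packing_size_le, rule packing_sum_le) (use K st in auto)
    finally show ?thesis .
  qed
  have "(\<lambda>n. K * 4 powr t * (p ^ n / (1 - p))) \<longlonglongrightarrow> K * 4 powr t * (0 / (1 - p))"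
    using p by (intro tendsto_intros LIMSEQ_power_zero) auto
  then have "(\<lambda>n. ennreal (K * 4 powr t * (p ^ n / (1 - p)))) \<longlonglongrightarrow> ennreal 0"
    by (intro tendsto_ennrealI) simp
  then have "packing_premeasure t F \<le> ennreal 0"
    by (rule LIMSEQ_le_const) (use bound in auto)
  then show ?thesis by simp
qed

lemma packing_measure_le_premeasure: "packing_measure s F \<le> packing_premeasure s F"
proof -
  have empty: "packing_premeasure s ({} :: 'a set) = 0"
  proof -
    have "packing_premeasure s ({} :: 'a set) \<le> packing_size 1 s ({} :: 'a set)"
      unfolding packing_premeasure_def by (intro INF_lower) simp
    also have "\<dots> \<le> ennreal 0" by (rule packing_size_le) auto
    finally show ?thesis by simp
  qed
  have "packing_measure s F \<le> (\<Sum>i. packing_premeasure s (if i = (0::nat) then F else {}))"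
    unfolding packing_measure_def by (rule INF_lower) auto
  also have "\<dots> = (\<Sum>i\<in>{0::nat}. packing_premeasure s (if i = 0 then F else {}))"
    by (rule suminf_finite) (auto simp: empty)
  finally show ?thesis by simp
qed

text \<open>
  For exponents above the Assouad dimension already the premeasure vanishes, so the one-piece
  covering of the set by itself suffices in the packing measure.
\<close>

lemma packing_dim_le_assouad_dim:
  fixes F :: "'a::metric_space set"
  assumes "bounded F"
  shows "packing_dim F \<le> assouad_dim F"
  unfolding assouad_dim_def
proof (rule Inf_greatest, safe)
  fix s C :: real
  assume s: "0 \<le> s" and C: "0 < C"
    and cover: "\<forall>r R. \<forall>x\<in>F. 0 < r \<longrightarrow> r < R \<longrightarrow>
        (\<exists>A. finite A \<and> real (card A) \<le> C * (R / r) powr s \<and>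
             ball x R \<inter> F \<subseteq> (\<Union>y\<in>A. ball y r))"
  show "packing_dim F \<le> ereal s"
  proof (rule dense_ge)
    fix t' assume "ereal s < t'"
    then obtain t where t: "s < t" "ereal t < t'" using ereal_dense2[of "ereal s" t'] by auto
    have "packing_measure t F = 0"
      using packing_measure_le_premeasure[of t F]
        packing_premeasure_eq_0[OF assms C _ s t(1)] cover by (simp add: assouad_bound_def)
    then have "packing_dim F \<le> ereal t"
      unfolding packing_dim_def using s t by (intro Inf_lower) auto
    then show "packing_dim F \<le> t'" using t by simp
  qed
qed

section \<open>Assouad and regularity dimension\<close>

context borel_prob_space
begin

text \<open>
  The balls of radius \<open>r / 2\<close> about the points of an \<open>r\<close>-separated set are disjoint and lie in
  \<open>B(x, 2 R)\<close>. Each of them has a fixed proportion of the mass of \<open>B(x, 2 R)\<close>, because the latter is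
  contained in the ball of radius \<open>3 R\<close> about the same point; the constant \<open>6\<^sup>s\<close> comes from the ratio
  \<open>6 R / r\<close> of the radii \<open>3 R\<close> and \<open>r / 2\<close>.
\<close>

lemma card_separated_in_ball_le:
  assumes C: "C > 0"
    and reg: "\<And>r R x. x \<in> msupp M \<Longrightarrow> 0 < r \<Longrightarrow> r < R \<Longrightarrow>
      measure M (ball x R) / measure M (ball x r) \<le> C * (R / r) powr s"
    and x: "x \<in> msupp M" and r: "0 < r" "r < R"
    and P: "finite P" "P \<subseteq> ball x R \<inter> msupp M"
    and sep: "\<And>y z. y \<in> P \<Longrightarrow> z \<in> P \<Longrightarrow> y \<noteq> z \<Longrightarrow> r \<le> dist y z"
  shows "real (card P) \<le> C * 6 powr s * (R / r) powr s"
proof -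
  let ?m = "measure M (ball x (2 * R))" and ?K = "C * 6 powr s * (R / r) powr s"
  have m: "0 < ?m" using x r by (intro measure_ball_pos) auto
  have one: "?m \<le> ?K * measure M (ball y (r / 2))" if y: "y \<in> P" for y
  proof -
    have ys: "y \<in> msupp M" "dist x y < R" using P y by auto
    have "ball x (2 * R) \<subseteq> ball y (3 * R)"
    proof
      fix z assume "z \<in> ball x (2 * R)"
      then show "z \<in> ball y (3 * R)" using ys dist_triangle[of y z x] by (simp add: dist_commute)
    qed
    then have "?m \<le> measure M (ball y (3 * R))" by (intro finite_measure_mono) auto
    also have "\<dots> \<le> C * (3 * R / (r / 2)) powr s * measure M (ball y (r / 2))"
      using reg[OF ys(1), of "r / 2" "3 * R"] r measure_ball_pos[OF ys(1), of "r / 2"]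
      by (simp add: divide_le_eq)
    also have "3 * R / (r / 2) = 6 * (R / r)" by simp
    also have "(6 * (R / r)) powr s = 6 powr s * (R / r) powr s"
      by (rule powr_mult)
    finally show ?thesis by (simp add: mult_ac)
  qed
  have disj: "disjoint_family_on (\<lambda>y. ball y (r / 2)) P"
    unfolding disjoint_family_on_def using sep by (intro ballI impI disjoint_ballI) simp
  have sub: "(\<Union>y\<in>P. ball y (r / 2)) \<subseteq> ball x (2 * R)"
  proof (safe)
    fix y z assume "y \<in> P" and z: "z \<in> ball y (r / 2)"
    then have "dist x y < R" using P by auto
    then show "z \<in> ball x (2 * R)" using z r dist_triangle[of x z y] by simp
  qed
  have "real (card P) * ?m \<le> (\<Sum>y\<in>P. ?K * measure M (ball y (r / 2)))"
    using sum_mono[of P "\<lambda>_. ?m", OF one] by simp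
  also have "\<dots> = ?K * measure M (\<Union>y\<in>P. ball y (r / 2))"
    using P disj by (subst finite_measure_finite_Union) (auto simp: sum_distrib_left)
  also have "\<dots> \<le> ?K * ?m"
    using sub C by (intro mult_left_mono finite_measure_mono) auto
  finally show ?thesis using m by simp
qed

text \<open>
  The cardinality bound also guarantees that a separated subset of largest cardinality exists, and the
  balls of radius \<open>r\<close> about its points cover, since an uncovered point could be added to it.
\<close>

lemma assouad_dim_msupp_le_upper_reg_dim: "assouad_dim (msupp M) \<le> upper_reg_dim M"
  unfolding upper_reg_dim_def
proof (rule Inf_greatest, safe)
  fix s C :: real
  assume s: "0 \<le> s" and C: "0 < C"
    and reg: "\<forall>r R. \<forall>x\<in>msupp M. 0 < r \<longrightarrow> r < R \<longrightarrow>
      measure M (ball x R) / measure M (ball x r) \<le> C * (R / r) powr s"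
  let ?K = "C * 6 powr s"
  have "\<exists>A. finite A \<and> real (card A) \<le> ?K * (R / r) powr s \<and>
      ball x R \<inter> msupp M \<subseteq> (\<Union>y\<in>A. ball y r)"
    if r: "0 < r" "r < R" and x: "x \<in> msupp M" for r R x
  proof -
    define sep where "sep P \<longleftrightarrow> finite P \<and> P \<subseteq> ball x R \<inter> msupp M \<and>
      (\<forall>y\<in>P. \<forall>z\<in>P. y \<noteq> z \<longrightarrow> r \<le> dist y z)" for P
    have card: "real (card P) \<le> ?K * (R / r) powr s" if "sep P" for P
      by (rule card_separated_in_ball_le[OF C _ x r]) (use reg that in \<open>auto simp: sep_def\<close>)
    obtain N where "?K * (R / r) powr s < real N" using reals_Archimedean2 by blast
    then have "\<forall>P. sep P \<longrightarrow> card P < N" using card by fastforce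
    moreover have "sep {}" by (simp add: sep_def)
    ultimately obtain P where P: "sep P" "\<And>Q. sep Q \<Longrightarrow> card Q \<le> card P"
      using ex_has_greatest_nat[of sep "{}" card N] by blast
    have "ball x R \<inter> msupp M \<subseteq> (\<Union>y\<in>P. ball y r)"
    proof (rule ccontr)
      assume "\<not> ?thesis"
      then obtain z where z: "z \<in> ball x R \<inter> msupp M" "\<forall>y\<in>P. r \<le> dist y z"
        by fastforce
      have "z \<notin> P" using z r by auto
      moreover have "sep (insert z P)" using P(1) z by (auto simp: sep_def dist_commute)
      ultimately show False using P(2)[of "insert z P"] P(1) by (simp add: sep_def)
    qed
    then show ?thesis using P(1) card by (auto simp: sep_def)
  qed
  then show "assouad_dim (msupp M) \<le> ereal s"
    unfolding assouad_dim_def using s C by (intro Inf_lower) (auto intro!: exI[of _ ?K])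
qed

end

section \<open>The two chains of inequalities\<close>

theorem theorem2p1:
  fixes \<mu> :: "'a::euclidean_space measure"
  assumes "prob_space \<mu>"
    and "sets \<mu> = sets borel"
    and "compact (msupp \<mu>)"
  shows "(upper_packing_dim \<mu> \<le> (SUP x\<in>msupp \<mu>. upper_local_dim \<mu> x) \<and>
          (SUP x\<in>msupp \<mu>. upper_local_dim \<mu> x) \<le> spectrum_top \<mu> \<and>
          spectrum_top \<mu> \<le> upper_reg_dim \<mu>) \<and>
         (upper_packing_dim \<mu> \<le> packing_dim (msupp \<mu>) \<and>
          packing_dim (msupp \<mu>) \<le> assouad_dim (msupp \<mu>) \<and>
          assouad_dim (msupp \<mu>) \<le> upper_reg_dim \<mu>)"
proof -
  interpret borel_prob_space \<mu>
    by (rule borel_prob_space.intro[OF assms(1)]) (unfold_locales, fact assms(2))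
  have bdd: "bounded (msupp \<mu>)" using assms(3) by (rule compact_imp_bounded)
  have "(SUP x\<in>msupp \<mu>. upper_local_dim \<mu> x) \<le> spectrum_top \<mu>"
    by (intro SUP_least upper_local_dim_le_spectrum_top)
  then show ?thesis
    using upper_packing_dim_le_SUP spectrum_top_le_upper_reg_dim[OF bdd]
      upper_packing_dim_le_packing_dim[OF borel_prob_space_axioms]
      packing_dim_le_assouad_dim[OF bdd] assouad_dim_msupp_le_upper_reg_dim
    by blast
qed

end
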